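(* Assume $\operatorname{rank} W_0 = n+m$. The indirect problem (I) and the direct problem (D) defined in the context are equivalent in the sense that their cost functions coincide and their feasible sets coincide: both have cost $\operatorname{trace}(QP+K^\top RKP)$, and a pair $(P,K)$ is feasible for (I) if and only if there exists $G$ such that $(P,K,G)$ is feasible for (D).
   Context: Data: $u(k)\in\mathbb R^m$, $x(k)\in\mathbb R^n$ are generated by $x(k+1)=Ax(k)+Bu(k)+d(k)$ with unknown real matrices $A\in\mathbb R^{n\times n}$, $B\in\mathbb R^{n\times m}$, $(A,B)$ stabilizable, and an arbitrary unknown disturbance $d(k)\in\mathbb R^n$. Set $U_0=[u(0)\ \cdots\ u(T-1)]\in\mathbb R^{m\times T}$, $X_0=[x(0)\ \cdots\ x(T-1)]\in\mathbb R^{n\times T}$, $X_1=[x(1)\ \cdots\ x(T)]\in\mathbb R^{n\times T}$, $D_0=[d(0)\ \cdots\ d(T-1)]\in\mathbb R^{n\times T}$, so that $X_1-D_0=[B\ \ A]W_0$, where $W_0=\begin{bmatrix}U_0\\ X_0\end{bmatrix}\in\mathbb R^{(n+m)\times T}$. When $\operatorname{rank}W_0=n+m$, $W_0^\dagger=W_0^\top(W_0W_0^\top)^{-1}$ denotes the (Moore–Penrose) right inverse. $Q\in\mathbb R^{n\times n}$ and $R\in\mathbb R^{m\times m}$ are symmetric positive definite. $P\in\mathbb R^{n\times n}$ is symmetric, $K\in\mathbb R^{m\times n}$, $G\in\mathbb R^{T\times n}$; $\succeq,\preceq$ is the semidefinite order; $\|\cdot\|_F$ is the Frobenius norm. Problem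 (I) (indirect certainty-equivalence LQR): minimize $\operatorname{trace}(QP+K^\top RKP)$ over $P\succeq I$ and $K$, subject to $(\hat A+\hat BK)P(\hat A+\hat BK)^\top-P+I\preceq0$ and $[\hat B\ \ \hat A]=\arg\min_{B,A}\|X_1-[B\ \ A]W_0\|_F$. Problem (D) (direct LQR): minimize $\operatorname{trace}(QP+K^\top RKP)$ over $P\succeq I$, $K$ and $G$, subject to $X_1GPG^\top X_1^\top-P+I\preceq0$, $\begin{bmatrix}K\\ I\end{bmatrix}=W_0G$, and $(I-W_0^\dagger W_0)G=0$. *)

theory Defs
  imports "HOL-Analysis.Analysis"
begin

section \<open>Block matrices\<close>

text \<open>\<open>hcat B A\<close> is the block row $[B\ \ A]$; \<open>vcat U X\<close> stacks \<open>U\<close> on top of \<open>X\<close>.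
  The block dimension $m + n$ is the cardinality of the sum type of the two index types.\<close>

definition hcat :: "real^'m^'k \<Rightarrow> real^'n^'k \<Rightarrow> real^('m + 'n)^'k" where
  "hcat B A = (\<chi> i j. case j of Inl a \<Rightarrow> B $ i $ a | Inr b \<Rightarrow> A $ i $ b)"

definition vcat :: "real^'k^'m \<Rightarrow> real^'k^'n \<Rightarrow> real^'k^('m + 'n)" where
  "vcat U X = (\<chi> i j. case i of Inl a \<Rightarrow> U $ a $ j | Inr b \<Rightarrow> X $ b $ j)"

lemma hcat_mult_vcat:
  "hcat B A ** vcat U X = B ** U + A ** X"
  by (simp add: hcat_def vcat_def matrix_matrix_mult_def vec_eq_iff
      UNIV_Plus_UNIV[symmetric] sum.Plus del: UNIV_Plus_UNIV)


section \<open>Data matrices\<close>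

text \<open>The $T$ columns are indexed by a finite linearly ordered type of cardinality $T$;
  its elements in increasing order stand for the sampling times $0, \dots, T - 1$.\<close>

definition col_time :: "'t::{finite,linorder} \<Rightarrow> nat" where
  "col_time t = card {s. s < t}"

lemma bij_col_time:
  "bij_betw (col_time :: 't::{finite,linorder} \<Rightarrow> nat) UNIV {..<CARD('t)}"
proof -
  have mono: "col_time s < col_time t" if "s < t" for s t :: 't
    unfolding col_time_def using that by (intro psubset_card_mono) auto
  have inj: "inj (col_time :: 't \<Rightarrow> nat)"
    by (rule linorder_injI) (metis mono less_irrefl)
  have "col_time t < CARD('t)" for t :: 't
    unfolding col_time_def by (intro psubset_card_mono) auto
  then have "range (col_time :: 't \<Rightarrow> nat) \<subseteq> {..<CARD('t)}" by auto
  moreover have "card (range (col_time :: 't \<Rightarrow> nat)) = card {..<CARD('t)}"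
    using inj by (simp add: card_image)
  ultimately have "range (col_time :: 't \<Rightarrow> nat) = {..<CARD('t)}"
    by (intro card_subset_eq) auto
  then show ?thesis using inj by (simp add: bij_betw_def)
qed

text \<open>\<open>data_matrix k0 z\<close> is $[z(k_0)\ \ z(k_0 + 1)\ \cdots\ z(k_0 + T - 1)]$.\<close>

definition data_matrix :: "nat \<Rightarrow> (nat \<Rightarrow> real^'n) \<Rightarrow> real^'t::{finite,linorder}^'n" where
  "data_matrix k0 z = (\<chi> i t. z (k0 + col_time t) $ i)"


section \<open>Matrix notions\<close>

definition frobenius_norm :: "real^'k^'n \<Rightarrow> real" where
  "frobenius_norm M = sqrt (\<Sum>i\<in>UNIV. \<Sum>j\<in>UNIV. (M $ i $ j)\<^sup>2)"

lemma frobenius_norm_eq_norm: "frobenius_norm M = norm M"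
  by (simp add: frobenius_norm_def norm_vec_def L2_set_def sum_nonneg)

definition symmetric_matrix :: "real^'n^'n \<Rightarrow> bool" where
  "symmetric_matrix M \<longleftrightarrow> transpose M = M"

definition pos_def :: "real^'n^'n \<Rightarrow> bool" where
  "pos_def M \<longleftrightarrow> symmetric_matrix M \<and> (\<forall>v. v \<noteq> 0 \<longrightarrow> 0 < v \<bullet> (M *v v))"

definition pos_semidef :: "real^'n^'n \<Rightarrow> bool" where
  "pos_semidef M \<longleftrightarrow> symmetric_matrix M \<and> (\<forall>v. 0 \<le> v \<bullet> (M *v v))"

definition loewner_le :: "real^'n^'n \<Rightarrow> real^'n^'n \<Rightarrow> bool"  (infix \<open>\<preceq>\<close> 50) where
  "M \<preceq> N \<longleftrightarrow> pos_semidef (N - M)"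

definition right_pinv :: "real^'k^'n \<Rightarrow> real^'n^'k" where
  "right_pinv W = transpose W ** matrix_inv (W ** transpose W)"

text \<open>Discrete-time stability: every complex eigenvalue lies in the open unit disc.\<close>

definition schur_stable :: "real^'n^'n \<Rightarrow> bool" where
  "schur_stable M \<longleftrightarrow>
    (\<forall>(l::complex) v. v \<noteq> 0 \<and> map_matrix complex_of_real M *v v = l *s v \<longrightarrow> cmod l < 1)"

definition stabilizable :: "real^'n^'n \<Rightarrow> real^'m^'n \<Rightarrow> bool" where
  "stabilizable A B \<longleftrightarrow> (\<exists>K :: real^'n^'m. schur_stable (A + B ** K))"


section \<open>The indirect and the direct problem\<close>

definition cost_I :: "real^'n^'n \<Rightarrow> real^'m^'m \<Rightarrow> (real^'n^'n) \<times> (real^'n^'m) \<Rightarrow> real" where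
  "cost_I Q R = (\<lambda>(P, K). trace (Q ** P + transpose K ** R ** K ** P))"

definition feasible_I ::
  "real^'t^'n \<Rightarrow> real^'t^('m + 'n) \<Rightarrow> ((real^'n^'n) \<times> (real^'n^'m)) set" where
  "feasible_I X1 W0 = {(P, K).
     symmetric_matrix P \<and> mat 1 \<preceq> P \<and>
     (\<exists>(Bh :: real^'m^'n) (Ah :: real^'n^'n).
        is_arg_min (\<lambda>(B, A). frobenius_norm (X1 - hcat B A ** W0)) (\<lambda>_. True) (Bh, Ah) \<and>
        (Ah + Bh ** K) ** P ** transpose (Ah + Bh ** K) - P + mat 1 \<preceq> 0)}"

definition cost_D ::
  "real^'n^'n \<Rightarrow> real^'m^'m \<Rightarrow> (real^'n^'n) \<times> (real^'n^'m) \<times> (real^'n^'t) \<Rightarrow> real" where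
  "cost_D Q R = (\<lambda>(P, K, G). trace (Q ** P + transpose K ** R ** K ** P))"

definition feasible_D ::
  "real^'t^'n \<Rightarrow> real^'t^('m + 'n) \<Rightarrow> ((real^'n^'n) \<times> (real^'n^'m) \<times> (real^'n^'t)) set" where
  "feasible_D X1 W0 = {(P, K, G).
     symmetric_matrix P \<and> mat 1 \<preceq> P \<and>
     X1 ** G ** P ** transpose G ** transpose X1 - P + mat 1 \<preceq> 0 \<and>
     vcat K (mat 1) = W0 ** G \<and>
     (mat 1 - right_pinv W0 ** W0) ** G = 0}"

end

(* For a full row rank W with right inverse V = right_pinv W, the least-squares problem has the
   unique solution X1 V (Pythagoras: the residual X1 - X1 V W is Frobenius-orthogonal to all N W).
   In (D), the constraints W G = [K; I] and (I - V W) G = 0 say exactly that G = V [K; I].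
   Hence both problems have closed loop A + B K = [B A] [K; I] = X1 V [K; I] = X1 G. *)
theory Submission
  imports Defs
begin

lemma matrix_diff_rdistrib:
  fixes A B :: "real^'k^'n" and C :: "real^'l^'k"
  shows "(A - B) ** C = A ** C - B ** C"
  by (simp add: matrix_matrix_mult_def vec_eq_iff left_diff_distrib sum_subtractf)

lemma matrix_inv_if_invertible:
  assumes "invertible M"
  shows "M ** matrix_inv M = mat 1" and "matrix_inv M ** M = mat 1"
  using someI_ex[OF assms[unfolded invertible_def]] by (simp_all add: matrix_inv_def)

text \<open>The inner product of nested vectors is the Frobenius one, so right multiplication by
  \<open>W\<close> has adjoint right multiplication by \<open>transpose W\<close>. This reduces
  orthogonality to all \<open>N ** W\<close> to a single matrix equation.\<close>

lemma matrix_inner_mult_right: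
  fixes E :: "real^'k^'n" and N :: "real^'l^'n" and W :: "real^'k^'l"
  shows "E \<bullet> (N ** W) = (E ** transpose W) \<bullet> N"
proof -
  have "(\<Sum>j\<in>UNIV. E $ i $ j * (\<Sum>k\<in>UNIV. N $ i $ k * W $ k $ j))
      = (\<Sum>k\<in>UNIV. (\<Sum>j\<in>UNIV. E $ i $ j * W $ k $ j) * N $ i $ k)" for i
    unfolding sum_distrib_left sum_distrib_right
    by (subst sum.swap) (simp add: mult_ac)
  then show ?thesis
    by (simp add: inner_vec_def matrix_matrix_mult_def transpose_def)
qed

text \<open>Full row rank makes \<open>transpose W\<close> injective, and the quadratic form of the
  Gram matrix at \<open>y\<close> is the squared norm of \<open>transpose W *v y\<close>, so its
  kernel is trivial.\<close>

lemma invertible_gram_if_full_row_rank: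
  fixes W :: "real^'k^'n"
  assumes "rank W = CARD('n)"
  shows "invertible (W ** transpose W)"
proof -
  have "inj ((*v) (transpose W))"
    using assms full_rank_injective[of "transpose W"] by (simp add: rank_transpose)
  then have inj0: "y = 0" if "transpose W *v y = 0" for y
    using that by (metis injD matrix_vector_mult_0_right)
  have "y = 0" if "(W ** transpose W) *v y = 0" for y
  proof -
    have "(transpose W *v y) \<bullet> (transpose W *v y) = y \<bullet> ((W ** transpose W) *v y)"
      by (simp add: dot_lmul_matrix[symmetric] matrix_vector_mul_assoc[symmetric]
          transpose_matrix_vector)
    then show ?thesis using that inj0 by simp
  qed
  then show ?thesis
    using matrix_left_invertible_ker[of "W ** transpose W"] invertible_left_inverse by blast
qed

lemma right_pinv_right_inverse:
  fixes W :: "real^'k^'n"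
  assumes "rank W = CARD('n)"
  shows "W ** right_pinv W = mat 1"
  using matrix_inv_if_invertible(1)[OF invertible_gram_if_full_row_rank[OF assms]]
  by (simp add: right_pinv_def matrix_mul_assoc)

lemma least_squares_pythagoras:
  fixes W :: "real^'k^'l" and X :: "real^'k^'n"
  assumes "rank W = CARD('l)"
  shows "(norm (X - M ** W))\<^sup>2 =
    (norm (X - X ** right_pinv W ** W))\<^sup>2 + (norm ((X ** right_pinv W - M) ** W))\<^sup>2"
proof -
  let ?E = "X - X ** right_pinv W ** W" and ?N = "X ** right_pinv W - M"
  \<comment> \<open>The Gram matrix cancels the inverse inside \<open>right_pinv W\<close>; this
    gives the normal equations \<open>?E ** transpose W = 0\<close>.\<close>
  have "right_pinv W ** (W ** transpose W) = transpose W"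
    using matrix_inv_if_invertible(2)[OF invertible_gram_if_full_row_rank[OF assms]]
    by (simp add: right_pinv_def matrix_mul_assoc[symmetric])
  then have "?E ** transpose W = 0"
    by (simp add: matrix_diff_rdistrib matrix_mul_assoc[symmetric])
  then have "?E \<bullet> (?N ** W) = 0"
    by (simp add: matrix_inner_mult_right)
  moreover have "X - M ** W = ?E + ?N ** W"
    by (simp add: matrix_diff_rdistrib)
  ultimately show ?thesis
    by (metis norm_add_Pythagorean orthogonal_def)
qed

lemma least_squares_minimizer_iff:
  fixes W :: "real^'k^'l" and X :: "real^'k^'n"
  assumes "rank W = CARD('l)"
  shows "(\<forall>N. frobenius_norm (X - M ** W) \<le> frobenius_norm (X - N ** W))
    \<longleftrightarrow> M = X ** right_pinv W" (is "?min \<longleftrightarrow> _")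
proof
  assume ?min
  then have "(norm (X - M ** W))\<^sup>2 \<le> (norm (X - X ** right_pinv W ** W))\<^sup>2"
    by (simp add: frobenius_norm_eq_norm)
  \<comment> \<open>In the Pythagorean identity for \<open>M\<close>, minimality leaves no room for
    the second square.\<close>
  then have "(X ** right_pinv W - M) ** W = 0"
    using least_squares_pythagoras[OF assms, of X M] by simp
  \<comment> \<open>Uniqueness uses the right inverse: multiplying by it cancels
    \<open>W\<close>.\<close>
  then have "(X ** right_pinv W - M) ** (W ** right_pinv W) = 0"
    by (simp add: matrix_mul_assoc)
  then show "M = X ** right_pinv W"
    by (simp add: right_pinv_right_inverse[OF assms])
next
  assume M: "M = X ** right_pinv W"
  show ?min
  proof
    fix N
    have "(norm (X - M ** W))\<^sup>2 \<le> (norm (X - N ** W))\<^sup>2"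
      using least_squares_pythagoras[OF assms, of X N] by (simp add: M)
    then show "frobenius_norm (X - M ** W) \<le> frobenius_norm (X - N ** W)"
      by (simp add: frobenius_norm_eq_norm)
  qed
qed

text \<open>Splitting the columns along the sum type lets minimization over pairs
  \<open>(B, A)\<close> be replaced by minimization over all matrices.\<close>

lemma hcat_surj:
  obtains B A where "M = hcat B A"
proof
  show "M = hcat (\<chi> i a. M $ i $ Inl a) (\<chi> i b. M $ i $ Inr b)"
    by (simp add: hcat_def vec_eq_iff split: sum.split)
qed

lemma is_arg_min_least_squares_iff:
  fixes W :: "real^'k^('m::finite + 'n::finite)" and X :: "real^'k^'l"
  assumes "rank W = CARD('m + 'n)"
  shows "is_arg_min (\<lambda>(B, A). frobenius_norm (X - hcat B A ** W)) (\<lambda>_. True) (B, A)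
    \<longleftrightarrow> hcat B A = X ** right_pinv W"
proof -
  have "is_arg_min (\<lambda>(B, A). frobenius_norm (X - hcat B A ** W)) (\<lambda>_. True) (B, A)
    \<longleftrightarrow> (\<forall>N. frobenius_norm (X - hcat B A ** W) \<le> frobenius_norm (X - N ** W))"
    unfolding is_arg_min_linorder by (simp, metis hcat_surj)
  then show ?thesis
    by (simp add: least_squares_minimizer_iff[OF assms])
qed

text \<open>The second constraint reads \<open>G = right_pinv W ** (W ** G)\<close>, into which the
  first is substituted. Conversely, \<open>W ** right_pinv W = mat 1\<close> recovers
  \<open>V\<close>.\<close>

lemma kernel_constraint_iff:
  fixes W :: "real^'k^'l" and G :: "real^'n^'k"
  assumes "rank W = CARD('l)"
  shows "V = W ** G \<and> (mat 1 - right_pinv W ** W) ** G = 0 \<longleftrightarrow> G = right_pinv W ** V"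
proof (intro iffI conjI)
  assume "V = W ** G \<and> (mat 1 - right_pinv W ** W) ** G = 0"
  then show "G = right_pinv W ** V"
    by (simp add: matrix_diff_rdistrib matrix_mul_assoc)
next
  assume G: "G = right_pinv W ** V"
  then show V: "V = W ** G"
    by (simp add: matrix_mul_assoc right_pinv_right_inverse[OF assms])
  show "(mat 1 - right_pinv W ** W) ** G = 0"
    using G V by (simp add: matrix_diff_rdistrib matrix_mul_assoc[symmetric])
qed

lemma feasible_I_iff_feasible_D:
  fixes X1 :: "real^'t^'n" and W0 :: "real^'t^('m::finite + 'n::finite)"
  assumes rank: "rank W0 = CARD('m + 'n)"
  shows "(P, K) \<in> feasible_I X1 W0 \<longleftrightarrow> (\<exists>G. (P, K, G) \<in> feasible_D X1 W0)"
proof -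
  \<comment> \<open>Here \<open>V\<close> is the block column [K; I], not the right inverse;
    \<open>F\<close> is the closed loop common to both problems.\<close>
  define V where "V = vcat K (mat 1 :: real^'n^'n)"
  define F where "F = X1 ** right_pinv W0 ** V"
  let ?stable = "F ** P ** transpose F - P + mat 1 \<preceq> 0"
  have closed_loop: "Ah + Bh ** K = F" if "hcat Bh Ah = X1 ** right_pinv W0" for Bh Ah
    using hcat_mult_vcat[of Bh Ah K "mat 1"] that by (simp add: F_def V_def add.commute)
  have "(P, K) \<in> feasible_I X1 W0 \<longleftrightarrow> symmetric_matrix P \<and> mat 1 \<preceq> P \<and> ?stable"
    unfolding feasible_I_def
    by (simp add: is_arg_min_least_squares_iff[OF rank] closed_loop cong: conj_cong)
      \<comment> \<open>The estimates exist: the least-squares solution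
        \<open>X1 ** right_pinv W0\<close> splits into blocks.\<close>
      (metis hcat_surj)
  moreover have "(P, K, G) \<in> feasible_D X1 W0 \<longleftrightarrow>
      symmetric_matrix P \<and> mat 1 \<preceq> P \<and> ?stable \<and> G = right_pinv W0 ** V" for G
    using kernel_constraint_iff[OF rank, of V G]
    by (auto simp: feasible_D_def F_def V_def matrix_transpose_mul matrix_mul_assoc)
  \<comment> \<open>The only candidate for \<open>G\<close> is \<open>right_pinv W0 ** V\<close>, so
    the existential quantifier disappears.\<close>
  ultimately show ?thesis by simp
qed

theorem mainTheorem2:
  fixes A :: "real^'n^'n" and B :: "real^'m^'n"
    and u :: "nat \<Rightarrow> real^'m" and x d :: "nat \<Rightarrow> real^'n"
    and U0 :: "real^'t::{finite,linorder}^'m" and X0 X1 :: "real^'t::{finite,linorder}^'n"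
    and W0 :: "real^'t::{finite,linorder}^('m + 'n)"
    and Q :: "real^'n^'n" and R :: "real^'m^'m"
  assumes system: "\<And>k. x (k + 1) = A *v x k + B *v u k + d k"
    and stab: "stabilizable A B"
    and U0: "U0 = data_matrix 0 u"
    and X0: "X0 = data_matrix 0 x"
    and X1: "X1 = data_matrix 1 x"
    and W0: "W0 = vcat U0 X0"
    and Q: "pos_def Q"
    and R: "pos_def R"
    and rank_W0: "rank W0 = CARD('n) + CARD('m)"
  shows "(\<forall>P K (G :: real^'n^'t::{finite,linorder}).
            cost_I Q R (P, K) = trace (Q ** P + transpose K ** R ** K ** P) \<and>
            cost_D Q R (P, K, G) = trace (Q ** P + transpose K ** R ** K ** P)) \<and>
         (\<forall>P K. (P, K) \<in> feasible_I X1 W0 \<longleftrightarrow> (\<exists>G. (P, K, G) \<in> feasible_D X1 W0))"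
proof -
  have "rank W0 = CARD('m + 'n)"
    using rank_W0 by simp
  then show ?thesis
    by (simp add: cost_I_def cost_D_def feasible_I_iff_feasible_D)
qed

end
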